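(* There is a finite set $\mathcal{U}$ of unary operations on $\mathbb{N}$ which is a substitution basis for the class of unary Kalmár elementary functions; that is, the smallest set of unary operations $\mathbb{N}\to\mathbb{N}$ which contains $\mathcal{U}$, all constant unary operations and the identity function, and which is closed under composition, is equal to the set of all unary Kalmár elementary functions.
   Context: $\mathbb{N}$ is the set of non-negative integers. An ($r$-ary, $r\ge 1$) operation on $\mathbb{N}$ is a function $\mathbb{N}^r\to\mathbb{N}$. Truncated subtraction is $x \mathbin{\dot-} y:=\max(x-y,0)$. Closure under substitution means: if $f$ is $r$-ary and $g_1,\dots,g_r$ are $n$-ary operations in the set, then $\vec x\mapsto f(g_1(\vec x),\dots,g_r(\vec x))$ is in the set. The Kalmár elementary functions are the elements of the smallest set of operations on $\mathbb{N}$ that contains the constants, the projections, the addition, and the truncated subtraction, and that is closed under substitution, bounded summation ($(\vec x,y)\mapsto\sum_{z<y}f(\vec x,z)$), and bounded multiplication ($(\vec x,y)\mapsto\prod_{z<y}f(\vec x,z)$). A unary Kalmár elementary function is one of arity $1$. *)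

theory Defs
  imports Main
begin

text \<open>
  An \<open>r\<close>-ary operation on the natural numbers is represented by a function on lists, of which
  only the values on lists of length \<open>r\<close> are meaningful. Every rule below applies its
  argument operations only to lists of the proper length whenever the resulting operation is applied
  to a list of its proper length, so the remaining values never influence the meaningful ones.
  In the bounded sum and product the bound is the last argument; the parameter tuple before it may
  be empty. Subtraction on type \<^typ>\<open>nat\<close> is truncated subtraction.
\<close>

inductive kalmar_elementary :: "nat \<Rightarrow> (nat list \<Rightarrow> nat) \<Rightarrow> bool" where
  const: "r \<ge> 1 \<Longrightarrow> kalmar_elementary r (\<lambda>xs. c)"
| proj: "i < r \<Longrightarrow> kalmar_elementary r (\<lambda>xs. xs ! i)"
| add: "kalmar_elementary 2 (\<lambda>xs. xs ! 0 + xs ! 1)"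
| monus: "kalmar_elementary 2 (\<lambda>xs. xs ! 0 - xs ! 1)"
| subst: "kalmar_elementary r f \<Longrightarrow> length gs = r \<Longrightarrow> (\<And>g. g \<in> set gs \<Longrightarrow> kalmar_elementary n g)
    \<Longrightarrow> kalmar_elementary n (\<lambda>xs. f (map (\<lambda>g. g xs) gs))"
| bsum: "kalmar_elementary (Suc n) f
    \<Longrightarrow> kalmar_elementary (Suc n) (\<lambda>xs. \<Sum>z<last xs. f (butlast xs @ [z]))"
| bprod: "kalmar_elementary (Suc n) f
    \<Longrightarrow> kalmar_elementary (Suc n) (\<lambda>xs. \<Prod>z<last xs. f (butlast xs @ [z]))"

definition unary_kalmar_elementary :: "(nat \<Rightarrow> nat) set" where
  "unary_kalmar_elementary = {(\<lambda>x. F [x]) | F. kalmar_elementary 1 F}"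

inductive_set unary_substitution_closure :: "(nat \<Rightarrow> nat) set \<Rightarrow> (nat \<Rightarrow> nat) set"
  for U :: "(nat \<Rightarrow> nat) set" where
  base: "f \<in> U \<Longrightarrow> f \<in> unary_substitution_closure U"
| const: "(\<lambda>x. c) \<in> unary_substitution_closure U"
| ident: "id \<in> unary_substitution_closure U"
| comp: "f \<in> unary_substitution_closure U \<Longrightarrow> g \<in> unary_substitution_closure U
    \<Longrightarrow> f \<circ> g \<in> unary_substitution_closure U"

definition substitution_basis :: "(nat \<Rightarrow> nat) set \<Rightarrow> (nat \<Rightarrow> nat) set \<Rightarrow> bool" where
  "substitution_basis U C \<longleftrightarrow> unary_substitution_closure U = C"

end

theory Submission
  imports Defs "HOL-Library.Nat_Bijection"
begin

text \<open>
  With Cantor pairing, the unary elementary functions are the functions denoted by the terms of a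
  small language of unary combinators. A value \<open>v\<close> of the term with code \<open>e\<close> at \<open>x\<close> is witnessed
  by a finite set of claims \<open>(e', x', v')\<close> each of which follows from others in one evaluation
  step; such a set is coded by a number. Being a certificate is an elementary predicate, so the
  search for a certificate below a bound \<open>t\<close> is a single elementary function \<open>run\<close> of
  \<open>e, x, t\<close>. For a fixed term, a tower of exponentials in \<open>x\<close> of fixed height suffices as a
  bound. Hence every unary elementary function is \<open>run\<close> after iterates of \<open>t \<mapsto> 2^t\<close> and of
  \<open>e \<mapsto> e + 1\<close>, applied to the initial triple \<open>(0, x, x)\<close>; these are four unary functions.
\<close>

abbreviation pair :: "nat \<Rightarrow> nat \<Rightarrow> nat" where "pair a b \<equiv> prod_encode (a, b)"
abbreviation pfst :: "nat \<Rightarrow> nat" where "pfst z \<equiv> fst (prod_decode z)"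
abbreviation psnd :: "nat \<Rightarrow> nat" where "psnd z \<equiv> snd (prod_decode z)"

section \<open>Unary combinators over Cantor pairs\<close>

datatype uterm = Const nat | Fst | Snd | Add | Monus
  | Pair uterm uterm | Comp uterm uterm | Sum uterm | Prod uterm

text \<open>Several arguments travel as one Cantor pair. \<open>Sum\<close> and \<open>Prod\<close>
  take the parameters from its first component and the bound from its second, in line with
  \<open>bsum\<close> and \<open>bprod\<close>, where the bound comes last.\<close>

primrec eval :: "uterm \<Rightarrow> nat \<Rightarrow> nat" where
  "eval (Const c) = (\<lambda>x. c)"
| "eval Fst = (\<lambda>x. pfst x)"
| "eval Snd = (\<lambda>x. psnd x)"
| "eval Add = (\<lambda>x. pfst x + psnd x)"
| "eval Monus = (\<lambda>x. pfst x - psnd x)"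
| "eval (Pair a b) = (\<lambda>x. pair (eval a x) (eval b x))"
| "eval (Comp a b) = (\<lambda>x. eval a (eval b x))"
| "eval (Sum a) = (\<lambda>x. \<Sum>z<psnd x. eval a (pair (pfst x) z))"
| "eval (Prod a) = (\<lambda>x. \<Prod>z<psnd x. eval a (pair (pfst x) z))"

section \<open>Elementary functions as unary functions on coded tuples\<close>

text \<open>Nesting to the left makes an appended entry the outermost second component:
  \<open>psnd\<close> reads the last entry and \<open>pfst\<close> drops it, which fits a bound in
  last position.\<close>

definition encode :: "nat list \<Rightarrow> nat" where
  "encode xs = foldl pair 0 xs"

lemma encode_Nil [simp]: "encode [] = 0"
  by (simp add: encode_def)

lemma encode_snoc [simp]: "encode (xs @ [x]) = pair (encode xs) x"
  by (simp add: encode_def)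

lemma length_Suc_conv_snoc: "length xs = Suc n \<longleftrightarrow> (\<exists>ys y. xs = ys @ [y] \<and> length ys = n)"
  by (cases xs rule: rev_cases) auto

text \<open>\<open>Snd\<close> reads the last entry; each use of \<open>Fst\<close> strips one entry
  from the right end until the wanted entry is last.\<close>

lemma eval_nth:
  assumes "i < n"
  shows "\<exists>e. \<forall>xs. length xs = n \<longrightarrow> xs ! i = eval e (encode xs)"
  using assms
proof (induction n)
  case (Suc n)
  show ?case
  proof (cases "i = n")
    case True
    then show ?thesis
      by (intro exI[of _ Snd]) (auto simp: length_Suc_conv_snoc)
  next
    case False
    with Suc obtain e where "\<forall>xs. length xs = n \<longrightarrow> xs ! i = eval e (encode xs)"
      by auto
    with False Suc.prems show ?thesis
      by (intro exI[of _ "Comp e Fst"]) (auto simp: length_Suc_conv_snoc nth_append)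
  qed
qed simp

lemma eval_encode_map:
  assumes "\<And>g. g \<in> set gs \<Longrightarrow> \<exists>e. \<forall>xs. length xs = n \<longrightarrow> g xs = eval e (encode xs)"
  shows "\<exists>e. \<forall>xs. length xs = n \<longrightarrow> encode (map (\<lambda>g. g xs) gs) = eval e (encode xs)"
  using assms
proof (induction gs rule: rev_induct)
  case Nil
  show ?case by (intro exI[of _ "Const 0"]) simp
next
  case (snoc g gs)
  obtain d where "\<forall>xs. length xs = n \<longrightarrow> encode (map (\<lambda>g. g xs) gs) = eval d (encode xs)"
    using snoc.IH snoc.prems by auto
  moreover obtain e where "\<forall>xs. length xs = n \<longrightarrow> g xs = eval e (encode xs)"
    using snoc.prems[of g] by auto
  ultimately show ?case
    by (intro exI[of _ "Pair d e"]) simp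
qed

lemma kalmar_elementary_eval:
  assumes "kalmar_elementary n f"
  shows "\<exists>e. \<forall>xs. length xs = n \<longrightarrow> f xs = eval e (encode xs)"
  using assms
proof induction
  case (const r c)
  show ?case by (intro exI[of _ "Const c"]) simp
next
  case (proj i r)
  then show ?case by (rule eval_nth)
next
  case add
  show ?case
    \<comment> \<open>The list \<open>[a, b]\<close> has the code \<open>pair (pair 0 a) b\<close>,
      so \<open>a\<close> is reached by \<open>Snd\<close> after \<open>Fst\<close>.\<close>
    by (intro exI[of _ "Comp Add (Pair (Comp Snd Fst) Snd)"])
      (auto simp: length_Suc_conv_snoc numeral_2_eq_2 encode_def)
next
  case monus
  show ?case
    by (intro exI[of _ "Comp Monus (Pair (Comp Snd Fst) Snd)"])
      (auto simp: length_Suc_conv_snoc numeral_2_eq_2 encode_def)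
next
  case (subst r f gs n)
  from subst.IH(1) obtain d where d: "\<forall>xs. length xs = r \<longrightarrow> f xs = eval d (encode xs)" by blast
  obtain e where e: "\<forall>xs. length xs = n \<longrightarrow> encode (map (\<lambda>g. g xs) gs) = eval e (encode xs)"
    using eval_encode_map[of gs n] subst.IH(2) by blast
  from d e subst.hyps show ?case
    by (intro exI[of _ "Comp d e"]) simp
next
  case (bsum n f)
  then obtain e where "\<forall>xs. length xs = Suc n \<longrightarrow> f xs = eval e (encode xs)" by blast
  then show ?case
    by (intro exI[of _ "Sum e"]) (auto simp: length_Suc_conv_snoc)
next
  case (bprod n f)
  then obtain e where "\<forall>xs. length xs = Suc n \<longrightarrow> f xs = eval e (encode xs)" by blast
  then show ?case
    by (intro exI[of _ "Prod e"]) (auto simp: length_Suc_conv_snoc)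
qed

text \<open>The inductive predicate also constrains the values on lists of the wrong length, so it is not
  closed under equality of the meaningful values; this closure is.\<close>

definition kalmar_on :: "nat \<Rightarrow> (nat list \<Rightarrow> nat) \<Rightarrow> bool" where
  "kalmar_on n f \<longleftrightarrow> (\<exists>F. kalmar_elementary n F \<and> (\<forall>xs. length xs = n \<longrightarrow> F xs = f xs))"

lemma kalmar_onI: "kalmar_elementary n f \<Longrightarrow> kalmar_on n f"
  by (auto simp: kalmar_on_def)

lemma kalmar_on_cong:
  "kalmar_on n f \<Longrightarrow> (\<And>xs. length xs = n \<Longrightarrow> f xs = g xs) \<Longrightarrow> kalmar_on n g"
  by (auto simp: kalmar_on_def)

lemma kalmar_on_const: "n \<ge> 1 \<Longrightarrow> kalmar_on n (\<lambda>xs. c)"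
  by (intro kalmar_onI kalmar_elementary.const)

lemma kalmar_on_nth: "i < n \<Longrightarrow> kalmar_on n (\<lambda>xs. xs ! i)"
  by (intro kalmar_onI kalmar_elementary.proj)

text \<open>Passing to elementary representatives changes nothing on lists of length
  \<open>n\<close>: the representative \<open>F\<close> then only sees lists of length
  \<open>r\<close>, where it agrees with \<open>f\<close>.\<close>

lemma kalmar_on_subst:
  assumes "kalmar_on r f" and "length gs = r" and "\<And>g. g \<in> set gs \<Longrightarrow> kalmar_on n g"
  shows "kalmar_on n (\<lambda>xs. f (map (\<lambda>g. g xs) gs))"
proof -
  obtain F where F: "kalmar_elementary r F" "\<And>xs. length xs = r \<Longrightarrow> F xs = f xs"
    using assms(1) by (auto simp: kalmar_on_def)
  have "\<forall>g\<in>set gs. \<exists>G. kalmar_elementary n G \<and> (\<forall>xs. length xs = n \<longrightarrow> G xs = g xs)"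
    using assms(3) by (auto simp: kalmar_on_def)
  then obtain G
    where G: "\<And>g. g \<in> set gs \<Longrightarrow> kalmar_elementary n (G g)"
      "\<And>g xs. g \<in> set gs \<Longrightarrow> length xs = n \<Longrightarrow> G g xs = g xs"
    by metis
  have "kalmar_elementary n (\<lambda>xs. F (map (\<lambda>g. g xs) (map G gs)))"
    by (rule kalmar_elementary.subst[OF F(1)]) (use assms(2) G(1) in auto)
  moreover have "F (map (\<lambda>g. g xs) (map G gs)) = f (map (\<lambda>g. g xs) gs)" if "length xs = n" for xs
  proof -
    have "map (\<lambda>g. g xs) (map G gs) = map (\<lambda>g. g xs) gs"
      using G(2) that by simp
    from arg_cong[OF this, of F] show ?thesis using F(2) assms(2) by simp
  qed
  ultimately show ?thesis unfolding kalmar_on_def by blast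
qed

lemma kalmar_on_compose:
  assumes "kalmar_on 1 (\<lambda>xs. f (xs ! 0))" and "kalmar_on n g"
  shows "kalmar_on n (\<lambda>xs. f (g xs))"
  using kalmar_on_subst[OF assms(1), of "[g]" n] assms(2) by simp

lemma kalmar_on_compose2:
  assumes "kalmar_on 2 (\<lambda>xs. f (xs ! 0) (xs ! 1))" and "kalmar_on n g" and "kalmar_on n h"
  shows "kalmar_on n (\<lambda>xs. f (g xs) (h xs))"
  using kalmar_on_subst[OF assms(1), of "[g, h]" n] assms(2,3) by auto

lemma kalmar_on_add: "kalmar_on n f \<Longrightarrow> kalmar_on n g \<Longrightarrow> kalmar_on n (\<lambda>xs. f xs + g xs)"
  by (rule kalmar_on_compose2) (intro kalmar_onI kalmar_elementary.add)

lemma kalmar_on_monus: "kalmar_on n f \<Longrightarrow> kalmar_on n g \<Longrightarrow> kalmar_on n (\<lambda>xs. f xs - g xs)"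
  by (rule kalmar_on_compose2) (intro kalmar_onI kalmar_elementary.monus)

text \<open>\<open>bsum\<close> and \<open>bprod\<close> use the last argument itself as limit.
  Substituting the \<open>n\<close> projections followed by \<open>h\<close> replaces that limit by
  a function of the parameters.\<close>

lemma kalmar_on_subst_last:
  assumes "kalmar_on (Suc n) (\<lambda>xs. F (butlast xs) (last xs))" and "kalmar_on n h"
  shows "kalmar_on n (\<lambda>xs. F xs (h xs))"
proof (rule kalmar_on_cong)
  let ?gs = "map (\<lambda>i xs. xs ! i) [0..<n] @ [h]"
  show "kalmar_on n (\<lambda>xs. (\<lambda>xs. F (butlast xs) (last xs)) (map (\<lambda>g. g xs) ?gs))"
    by (rule kalmar_on_subst[OF assms(1)]) (auto intro: kalmar_on_nth assms(2))
  show "(\<lambda>xs. F (butlast xs) (last xs)) (map (\<lambda>g. g xs) ?gs) = F xs (h xs)"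
    if "length xs = n" for xs
  proof -
    have "map (\<lambda>g. g xs) ?gs = xs @ [h xs]"
      using that by (simp add: comp_def) (metis map_nth)
    then show ?thesis by simp
  qed
qed

lemma kalmar_on_sum:
  assumes "kalmar_on (Suc n) f" and "kalmar_on n h"
  shows "kalmar_on n (\<lambda>xs. \<Sum>z<h xs. f (xs @ [z]))"
proof (rule kalmar_on_subst_last[OF _ assms(2)])
  obtain F where F: "kalmar_elementary (Suc n) F" "\<And>xs. length xs = Suc n \<Longrightarrow> F xs = f xs"
    using assms(1) by (auto simp: kalmar_on_def)
  show "kalmar_on (Suc n) (\<lambda>xs. \<Sum>z<last xs. f (butlast xs @ [z]))"
    by (rule kalmar_on_cong[OF kalmar_onI[OF kalmar_elementary.bsum[OF F(1)]]]) (simp add: F(2))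
qed

lemma kalmar_on_prod:
  assumes "kalmar_on (Suc n) f" and "kalmar_on n h"
  shows "kalmar_on n (\<lambda>xs. \<Prod>z<h xs. f (xs @ [z]))"
proof (rule kalmar_on_subst_last[OF _ assms(2)])
  obtain F where F: "kalmar_elementary (Suc n) F" "\<And>xs. length xs = Suc n \<Longrightarrow> F xs = f xs"
    using assms(1) by (auto simp: kalmar_on_def)
  show "kalmar_on (Suc n) (\<lambda>xs. \<Prod>z<last xs. f (butlast xs @ [z]))"
    by (rule kalmar_on_cong[OF kalmar_onI[OF kalmar_elementary.bprod[OF F(1)]]]) (simp add: F(2))
qed

lemma kalmar_on_sum1:
  assumes "kalmar_on 2 (\<lambda>xs. f (xs ! 0) (xs ! 1))" and "kalmar_on 1 (\<lambda>xs. h (xs ! 0))"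
  shows "kalmar_on 1 (\<lambda>xs. \<Sum>z<h (xs ! 0). f (xs ! 0) z)"
  by (rule kalmar_on_cong[OF kalmar_on_sum[OF _ assms(2)]])
    (use assms(1) in \<open>auto simp: numeral_2_eq_2 nth_append\<close>)

lemma kalmar_on_prod1:
  assumes "kalmar_on 2 (\<lambda>xs. f (xs ! 0) (xs ! 1))" and "kalmar_on 1 (\<lambda>xs. h (xs ! 0))"
  shows "kalmar_on 1 (\<lambda>xs. \<Prod>z<h (xs ! 0). f (xs ! 0) z)"
  by (rule kalmar_on_cong[OF kalmar_on_prod[OF _ assms(2)]])
    (use assms(1) in \<open>auto simp: numeral_2_eq_2 nth_append\<close>)

section \<open>Cantor pairing and its projections are elementary\<close>

lemma triangle_mono: "m \<le> n \<Longrightarrow> triangle m \<le> triangle n"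
  by (rule lift_Suc_mono_le) auto

lemma triangle_ge: "n \<le> triangle n"
  by (induction n) auto

lemma triangle_eq_sum: "triangle n = (\<Sum>z<Suc n. z)"
  by (induction n) auto

lemma kalmar_on_triangle: "kalmar_on n f \<Longrightarrow> kalmar_on n (\<lambda>xs. triangle (f xs))"
  unfolding triangle_eq_sum Suc_eq_plus1
  by (rule kalmar_on_compose[where f = "\<lambda>x. \<Sum>z<x+1. z"],
      rule kalmar_on_sum1[where f = "\<lambda>x z. z"])
    (simp_all add: kalmar_on_nth kalmar_on_add kalmar_on_const del: One_nat_def)

lemma kalmar_on_pair:
  "kalmar_on n f \<Longrightarrow> kalmar_on n g \<Longrightarrow> kalmar_on n (\<lambda>xs. pair (f xs) (g xs))"
  by (simp add: prod_encode_def kalmar_on_triangle kalmar_on_add)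

text \<open>The code \<open>pair a b\<close> is \<open>triangle (a + b) + a\<close>, hence lies on
  the diagonal with index \<open>a + b\<close>. This index counts the diagonals of positive index
  that start at or below \<open>x\<close>: the summand is the indicator of
  \<open>triangle (j + 1) \<le> x\<close>, and \<open>x\<close> summands are enough because
  \<open>a + b \<le> x\<close>.\<close>

lemma pfst_add_psnd: "pfst x + psnd x = (\<Sum>j<x. 1 - (triangle (j + 1) - x))"
proof -
  obtain a b where x: "x = pair a b" by (metis prod.collapse prod_decode_inverse)
  have le: "a + b \<le> x" using triangle_ge[of "a + b"] by (simp add: x prod_encode_def)
  have iff: "triangle (j + 1) \<le> x \<longleftrightarrow> j < a + b" for j
  proof
    assume "j < a + b"
    then have "triangle (j + 1) \<le> triangle (a + b)" by (intro triangle_mono) simp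
    then show "triangle (j + 1) \<le> x" by (simp add: x prod_encode_def)
  next
    assume *: "triangle (j + 1) \<le> x"
    show "j < a + b"
    proof (rule ccontr)
      assume "\<not> j < a + b"
      \<comment> \<open>Diagonal \<open>a + b\<close> has \<open>a + b + 1\<close> entries, so the
        next one starts above \<open>x\<close>.\<close>
      then have "triangle (Suc (a + b)) \<le> triangle (j + 1)" by (intro triangle_mono) simp
      with * show False by (simp add: x prod_encode_def)
    qed
  qed
  have "1 - (triangle (j + 1) - x) = (if j < a + b then 1 else 0)" for j
    using iff[of j] by (cases "j < a + b") (simp_all del: triangle_Suc)
  then have "(\<Sum>j<x. 1 - (triangle (j + 1) - x)) = card ({..<x} \<inter> {j. j < a + b})"
    by (simp add: sum.If_cases)
  also have "{..<x} \<inter> {j. j < a + b} = {..<a + b}"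
    using le by auto
  finally show ?thesis by (simp add: x)
qed

lemma pfst_eq: "pfst x = x - triangle (pfst x + psnd x)"
proof -
  obtain a b where x: "x = pair a b" by (metis prod.collapse prod_decode_inverse)
  show ?thesis unfolding x prod_encode_inverse by (simp add: prod_encode_def)
qed

lemma kalmar_on_pfst_add_psnd: "kalmar_on 1 (\<lambda>xs. pfst (xs ! 0) + psnd (xs ! 0))"
  unfolding pfst_add_psnd
  by (rule kalmar_on_sum1[where f = "\<lambda>x j. 1 - (triangle (j + 1) - x)" and h = "\<lambda>x. x"])
    (intro kalmar_on_nth kalmar_on_monus kalmar_on_add kalmar_on_const
      kalmar_on_triangle, auto)+

lemma kalmar_on_pfst: "kalmar_on 1 (\<lambda>xs. pfst (xs ! 0))"
  by (subst pfst_eq) (intro kalmar_on_monus kalmar_on_nth kalmar_on_triangle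
      kalmar_on_pfst_add_psnd, simp)

lemma kalmar_on_psnd: "kalmar_on 1 (\<lambda>xs. psnd (xs ! 0))"
  using kalmar_on_monus[OF kalmar_on_pfst_add_psnd kalmar_on_pfst] by simp

lemma kalmar_on_eval: "kalmar_on 1 (\<lambda>xs. eval e (xs ! 0))"
proof (induction e)
  case (Sum e)
  have "kalmar_on 2 (\<lambda>xs. eval e (pair (pfst (xs ! 0)) (xs ! 1)))"
    by (intro kalmar_on_compose[OF Sum] kalmar_on_pair kalmar_on_compose[OF kalmar_on_pfst]
        kalmar_on_nth) auto
  from kalmar_on_sum1[OF this kalmar_on_psnd] show ?case by simp
next
  case (Prod e)
  have "kalmar_on 2 (\<lambda>xs. eval e (pair (pfst (xs ! 0)) (xs ! 1)))"
    by (intro kalmar_on_compose[OF Prod] kalmar_on_pair kalmar_on_compose[OF kalmar_on_pfst]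
        kalmar_on_nth) auto
  from kalmar_on_prod1[OF this kalmar_on_psnd] show ?case by simp
next
  case (Comp a b)
  from kalmar_on_compose[OF this] show ?case by simp
qed (auto simp del: One_nat_def intro: kalmar_on_const kalmar_on_pfst kalmar_on_psnd kalmar_on_pfst_add_psnd
    kalmar_on_monus kalmar_on_pair)

theorem unary_kalmar_elementary_eq: "unary_kalmar_elementary = range eval"
proof (intro equalityI subsetI)
  fix f assume "f \<in> unary_kalmar_elementary"
  then obtain F where F: "kalmar_elementary 1 F" "f = (\<lambda>x. F [x])"
    by (auto simp: unary_kalmar_elementary_def)
  obtain e where e: "\<And>xs. length xs = 1 \<Longrightarrow> F xs = eval e (encode xs)"
    using kalmar_elementary_eval[OF F(1)] by auto
  \<comment> \<open>\<open>pair 0 x\<close> is the code of the list \<open>[x]\<close>, and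
    \<open>Pair Fst Snd\<close> denotes the identity because every number is a Cantor pair.\<close>
  have "f = eval (Comp e (Pair (Const 0) (Pair Fst Snd)))"
    by (auto simp: F(2) e fun_eq_iff encode_def)
  then show "f \<in> range eval" by blast
next
  fix f assume "f \<in> range eval"
  then obtain e where "f = eval e" by blast
  with kalmar_on_eval[of e] obtain F
    where F: "kalmar_elementary 1 F" "\<And>xs. length xs = 1 \<Longrightarrow> F xs = f (xs ! 0)"
    by (auto simp: kalmar_on_def)
  then have "f = (\<lambda>x. F [x])" by (simp add: fun_eq_iff)
  with F(1) show "f \<in> unary_kalmar_elementary"
    by (auto simp: unary_kalmar_elementary_def)
qed

section \<open>Expressing functions and predicates by terms\<close>

definition elem :: "(nat \<Rightarrow> nat) \<Rightarrow> bool" where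
  "elem f \<longleftrightarrow> f \<in> range eval"

definition elem_pred :: "(nat \<Rightarrow> bool) \<Rightarrow> bool" where
  "elem_pred P \<longleftrightarrow> elem (\<lambda>x. of_bool (P x))"

lemma elemI: "eval e = f \<Longrightarrow> elem f"
  by (auto simp: elem_def)

lemma elem_comp:
  assumes "elem f" and "elem g"
  shows "elem (\<lambda>x. f (g x))"
proof -
  obtain a b where "f = eval a" "g = eval b" using assms by (auto simp: elem_def)
  then show ?thesis by (intro elemI[of "Comp a b"]) simp
qed

lemma elem_const: "elem (\<lambda>x. c)"
  by (rule elemI[of "Const c"]) simp

lemma elem_id: "elem (\<lambda>x. x)"
  by (rule elemI[of "Pair Fst Snd"]) simp

lemma elem_pair:
  assumes "elem f" and "elem g"
  shows "elem (\<lambda>x. pair (f x) (g x))"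
proof -
  obtain a b where "f = eval a" "g = eval b" using assms by (auto simp: elem_def)
  then show ?thesis by (intro elemI[of "Pair a b"]) simp
qed

lemma elem_pfst: "elem f \<Longrightarrow> elem (\<lambda>x. pfst (f x))"
  by (rule elem_comp[OF elemI[of Fst]]) auto

lemma elem_psnd: "elem f \<Longrightarrow> elem (\<lambda>x. psnd (f x))"
  by (rule elem_comp[OF elemI[of Snd]]) auto

lemma elem_add: "elem f \<Longrightarrow> elem g \<Longrightarrow> elem (\<lambda>x. f x + g x)"
  using elem_comp[OF elemI[of Add] elem_pair, OF refl] by simp

lemma elem_monus: "elem f \<Longrightarrow> elem g \<Longrightarrow> elem (\<lambda>x. f x - g x)"
  using elem_comp[OF elemI[of Monus] elem_pair, OF refl] by simp

text \<open>A term takes a single number, so the summand is required to be elementary on coded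
  pairs; the sum is then evaluated at \<open>pair x (h x)\<close>.\<close>

lemma elem_sum:
  assumes "elem (\<lambda>p. f (pfst p) (psnd p))" and "elem h"
  shows "elem (\<lambda>x. \<Sum>z<h x. f x z)"
proof -
  obtain a where "eval a = (\<lambda>p. f (pfst p) (psnd p))" using assms(1) by (auto simp: elem_def)
  then have "elem (\<lambda>p. \<Sum>z<psnd p. f (pfst p) z)" by (intro elemI[of "Sum a"]) simp
  from elem_comp[OF this elem_pair[OF elem_id assms(2)]] show ?thesis by simp
qed

lemma elem_prod:
  assumes "elem (\<lambda>p. f (pfst p) (psnd p))" and "elem h"
  shows "elem (\<lambda>x. \<Prod>z<h x. f x z)"
proof -
  obtain a where "eval a = (\<lambda>p. f (pfst p) (psnd p))" using assms(1) by (auto simp: elem_def)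
  then have "elem (\<lambda>p. \<Prod>z<psnd p. f (pfst p) z)" by (intro elemI[of "Prod a"]) simp
  from elem_comp[OF this elem_pair[OF elem_id assms(2)]] show ?thesis by simp
qed

lemma elem_mult:
  assumes "elem f" and "elem g"
  shows "elem (\<lambda>x. f x * g x)"
proof -
  have "elem (\<lambda>x. \<Sum>z<f x. g x)"
    by (intro elem_sum elem_comp[OF assms(2)] elem_pfst elem_id assms(1))
  then show ?thesis by simp
qed

lemma elem_power:
  assumes "elem f" and "elem g"
  shows "elem (\<lambda>x. f x ^ g x)"
proof -
  have "elem (\<lambda>x. \<Prod>z<g x. f x)"
    by (intro elem_prod elem_comp[OF assms(1)] elem_pfst elem_id assms(2))
  then show ?thesis by simp
qed

lemma elem_of_bool: "elem_pred P \<Longrightarrow> elem (\<lambda>x. of_bool (P x))"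
  by (simp add: elem_pred_def)

lemma elem_pred_comp: "elem_pred P \<Longrightarrow> elem f \<Longrightarrow> elem_pred (\<lambda>x. P (f x))"
  unfolding elem_pred_def by (rule elem_comp)

lemma elem_pred_not:
  assumes "elem_pred P"
  shows "elem_pred (\<lambda>x. \<not> P x)"
proof -
  have "elem (\<lambda>x. 1 - of_bool (P x))" by (intro elem_monus elem_const elem_of_bool assms)
  moreover have "1 - of_bool (P x) = (of_bool (\<not> P x) :: nat)" for x by simp
  ultimately show ?thesis by (simp only: elem_pred_def)
qed

lemma elem_pred_conj: "elem_pred P \<Longrightarrow> elem_pred Q \<Longrightarrow> elem_pred (\<lambda>x. P x \<and> Q x)"
  using elem_mult[of "\<lambda>x. of_bool (P x)" "\<lambda>x. of_bool (Q x)"]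
  by (simp add: elem_pred_def of_bool_conj)

lemma elem_pred_disj: "elem_pred P \<Longrightarrow> elem_pred Q \<Longrightarrow> elem_pred (\<lambda>x. P x \<or> Q x)"
  using elem_pred_not[OF elem_pred_conj[OF elem_pred_not elem_pred_not], of P Q] by simp

lemma elem_pred_imp: "elem_pred P \<Longrightarrow> elem_pred Q \<Longrightarrow> elem_pred (\<lambda>x. P x \<longrightarrow> Q x)"
  using elem_pred_disj[OF elem_pred_not, of P Q] by simp

lemma elem_pred_le:
  assumes "elem f" and "elem g"
  shows "elem_pred (\<lambda>x. f x \<le> g x)"
proof -
  have "elem (\<lambda>x. 1 - (f x - g x))" by (intro elem_monus elem_const assms)
  moreover have "1 - (f x - g x) = of_bool (f x \<le> g x)" for x by auto
  ultimately show ?thesis by (simp add: elem_pred_def)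
qed

lemma elem_pred_less: "elem f \<Longrightarrow> elem g \<Longrightarrow> elem_pred (\<lambda>x. f x < g x)"
  using elem_pred_not[OF elem_pred_le, of g f] by (simp add: not_le)

lemma elem_pred_eq: "elem f \<Longrightarrow> elem g \<Longrightarrow> elem_pred (\<lambda>x. f x = g x)"
  using elem_pred_conj[OF elem_pred_le elem_pred_le, of f g g f] by (simp add: eq_iff)

lemma elem_pred_ball:
  assumes "elem_pred (\<lambda>p. P (pfst p) (psnd p))" and "elem h"
  shows "elem_pred (\<lambda>x. \<forall>z<h x. P x z)"
proof -
  have "elem (\<lambda>x. \<Prod>z<h x. of_bool (P x z))"
    by (intro elem_prod assms elem_of_bool)
  moreover have "(\<Prod>z<n. of_bool (P x z)) = (of_bool (\<forall>z<n. P x z) :: nat)" for x n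
    by (induction n) (auto simp: less_Suc_eq)
  ultimately show ?thesis by (simp add: elem_pred_def)
qed

lemma elem_pred_bex:
  assumes "elem_pred (\<lambda>p. P (pfst p) (psnd p))" and "elem h"
  shows "elem_pred (\<lambda>x. \<exists>z<h x. P x z)"
  using elem_pred_not[OF elem_pred_ball[of "\<lambda>x z. \<not> P x z", OF elem_pred_not]] assms by simp

section \<open>Finite sets coded by binary digits\<close>

text \<open>Splitting the binary expansion of \<open>s\<close> at digit \<open>m\<close> gives a
  higher part \<open>q\<close> and a lower part \<open>r\<close>. This replaces the division in
  \<open>set_decode\<close> by bounded quantifiers, sums, products and powers, all of which are
  known to be elementary.\<close>

lemma mem_set_decode_iff:
  "m \<in> set_decode s \<longleftrightarrow> (\<exists>q<Suc s. \<exists>r<2 ^ m. s = (2 * q + 1) * 2 ^ m + r)"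
proof
  assume "m \<in> set_decode s"
  then have "odd (s div 2 ^ m)" by (simp add: set_decode_def)
  then obtain q where q: "s div 2 ^ m = 2 * q + 1" by (elim oddE)
  have "q \<le> s div 2 ^ m" by (simp add: q)
  also have "\<dots> \<le> s" by simp
  finally have "q < Suc s" by simp
  moreover have "s = (2 * q + 1) * 2 ^ m + s mod 2 ^ m"
    using div_mult_mod_eq[of s "2 ^ m"] by (simp only: q)
  ultimately show "\<exists>q<Suc s. \<exists>r<2 ^ m. s = (2 * q + 1) * 2 ^ m + r"
    by (metis mod_less_divisor zero_less_numeral zero_less_power)
next
  assume "\<exists>q<Suc s. \<exists>r<2 ^ m. s = (2 * q + 1) * 2 ^ m + r"
  then obtain q r where "r < 2 ^ m" "s = (2 * q + 1) * 2 ^ m + r" by blast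
  then have "s div 2 ^ m = 2 * q + 1" by (simp del: mult_Suc)
  then show "m \<in> set_decode s" by (simp add: set_decode_def)
qed

text \<open>A member \<open>m\<close> contributes a digit of weight \<open>2 ^ m > m\<close>.
  Quantifiers over the members of a coded set thereby become bounded quantifiers.\<close>

lemma mem_set_decode_less:
  assumes "m \<in> set_decode s"
  shows "m < s"
proof -
  have "s div 2 ^ m \<noteq> 0" using assms by (auto simp: set_decode_def intro: ccontr)
  then have "2 ^ m \<le> s" by (meson div_less not_le)
  then show ?thesis using less_exp[of m] by linarith
qed

lemmas elem_intros = elem_const elem_id elem_pair elem_pfst elem_psnd elem_add elem_monus
  elem_mult elem_power elem_sum elem_of_bool elem_pred_conj elem_pred_disj
  elem_pred_imp elem_pred_le elem_pred_less elem_pred_eq elem_pred_ball elem_pred_bex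

lemma elem_pred_mem:
  assumes "elem f" and "elem g"
  shows "elem_pred (\<lambda>x. f x \<in> set_decode (g x))"
proof -
  have "elem_pred (\<lambda>p. pfst p \<in> set_decode (psnd p))"
    unfolding mem_set_decode_iff Suc_eq_plus1 by (intro elem_intros)
  from elem_pred_comp[OF this elem_pair[OF assms]] show ?thesis by simp
qed

section \<open>A universal function based on certificates\<close>

primrec code :: "uterm \<Rightarrow> nat" where
  "code (Const c) = pair 0 c"
| "code Fst = pair 1 0"
| "code Snd = pair 2 0"
| "code Add = pair 3 0"
| "code Monus = pair 4 0"
| "code (Pair a b) = pair 5 (pair (code a) (code b))"
| "code (Comp a b) = pair 6 (pair (code a) (code b))"
| "code (Sum a) = pair 7 (code a)"
| "code (Prod a) = pair 8 (code a)"

abbreviation claim :: "nat \<Rightarrow> nat \<Rightarrow> nat \<Rightarrow> nat" where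
  "claim e x v \<equiv> pair e (pair x v)"

text \<open>The tags are those of \<open>code\<close>. Under tags 7 and 8 a sum or product is
  unfolded one term at a time, through a claim for the same code \<open>e\<close> with the bound
  lowered by one, so that no clause relies on more than two other claims.\<close>

definition justified :: "nat set \<Rightarrow> nat \<Rightarrow> nat \<Rightarrow> nat \<Rightarrow> bool" where
  "justified A e x v \<longleftrightarrow>
     pfst e = 0 \<and> v = psnd e
   \<or> pfst e = 1 \<and> v = pfst x
   \<or> pfst e = 2 \<and> v = psnd x
   \<or> pfst e = 3 \<and> v = pfst x + psnd x
   \<or> pfst e = 4 \<and> v = pfst x - psnd x
   \<or> pfst e = 5 \<and> claim (pfst (psnd e)) x (pfst v) \<in> A \<and> claim (psnd (psnd e)) x (psnd v) \<in> A
   \<or> pfst e = 6 \<and> (\<exists>w. claim (psnd (psnd e)) x w \<in> A \<and> claim (pfst (psnd e)) w v \<in> A)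
   \<or> pfst e = 7 \<and> (psnd x = 0 \<and> v = 0 \<or> 0 < psnd x \<and>
       (\<exists>u w. v = u + w \<and> claim e (pair (pfst x) (psnd x - 1)) u \<in> A
          \<and> claim (psnd e) (pair (pfst x) (psnd x - 1)) w \<in> A))
   \<or> pfst e = 8 \<and> (psnd x = 0 \<and> v = 1 \<or> 0 < psnd x \<and>
       (\<exists>u w. v = u * w \<and> claim e (pair (pfst x) (psnd x - 1)) u \<in> A
          \<and> claim (psnd e) (pair (pfst x) (psnd x - 1)) w \<in> A))"

definition certificate :: "nat set \<Rightarrow> bool" where
  "certificate A \<longleftrightarrow> (\<forall>m\<in>A. justified A (pfst m) (pfst (psnd m)) (psnd (psnd m)))"

text \<open>The set occurs only positively in \<open>justified\<close>.\<close>

lemma justified_mono: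
  assumes "justified A e x v" and "A \<subseteq> B"
  shows "justified B e x v"
proof -
  have "justified A e x v \<longrightarrow> justified B e x v"
    unfolding justified_def
    by (intro disj_mono conj_mono ex_mono imp_refl in_mono[OF assms(2)])
  with assms(1) show ?thesis by blast
qed

lemma certificate_Union: "(\<And>A. A \<in> \<A> \<Longrightarrow> certificate A) \<Longrightarrow> certificate (\<Union>\<A>)"
  unfolding certificate_def by (blast intro: justified_mono)

lemma certificate_Un: "certificate A \<Longrightarrow> certificate B \<Longrightarrow> certificate (A \<union> B)"
  using certificate_Union[of "{A, B}"] by auto

lemma certificate_insert:
  "certificate A \<Longrightarrow> justified (insert (claim e x v) A) e x v \<Longrightarrow>
    certificate (insert (claim e x v) A)"
  unfolding certificate_def by (auto intro: justified_mono)

text \<open>The justification of a claim about a term refers to proper subterms and, for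
  \<open>Sum\<close> and \<open>Prod\<close>, to the same term at a smaller bound. Hence an
  induction on the term, with an inner induction on the bound.\<close>

lemma certificate_sound:
  assumes "certificate A"
  shows "claim (code e) x v \<in> A \<Longrightarrow> v = eval e x"
proof (induction e arbitrary: x v)
  case (Sum e)
  have "claim (code (Sum e)) (pair p y) v \<in> A \<Longrightarrow> v = (\<Sum>z<y. eval e (pair p z))" for p y v
  proof (induction y arbitrary: v)
    case 0
    with assms show ?case by (fastforce simp: certificate_def justified_def)
  next
    case (Suc y)
    with assms have "justified A (code (Sum e)) (pair p (Suc y)) v"
      by (fastforce simp: certificate_def)
    with Suc.IH Sum.IH show ?case by (auto simp: justified_def)
  qed
  from this[of "pfst x" "psnd x" v] Sum.prems show ?case by simp
next
  case (Prod e)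
  have "claim (code (Prod e)) (pair p y) v \<in> A \<Longrightarrow> v = (\<Prod>z<y. eval e (pair p z))" for p y v
  proof (induction y arbitrary: v)
    case 0
    with assms show ?case by (fastforce simp: certificate_def justified_def)
  next
    case (Suc y)
    with assms have "justified A (code (Prod e)) (pair p (Suc y)) v"
      by (fastforce simp: certificate_def)
    with Suc.IH Prod.IH show ?case by (auto simp: justified_def)
  qed
  from this[of "pfst x" "psnd x" v] Prod.prems show ?case by simp
next
  case (Pair a b)
  with assms have "justified A (code (Pair a b)) x v"
    by (fastforce simp: certificate_def)
  with Pair.IH have "pfst v = eval a x" "psnd v = eval b x" by (auto simp: justified_def)
  then show ?case by (metis eval.simps(6) prod.collapse prod_decode_inverse)
next
  case (Comp a b)
  with assms have "justified A (code (Comp a b)) x v"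
    by (fastforce simp: certificate_def)
  with Comp.IH show ?case by (auto simp: justified_def)
qed (use assms in \<open>fastforce simp: certificate_def justified_def\<close>)+

text \<open>By soundness at most one summand is nonzero, so the sum just selects the certified value.\<close>

definition run :: "nat \<Rightarrow> nat" where
  "run p = (\<Sum>v<psnd p. v * of_bool (\<exists>s<psnd p. certificate (set_decode s)
     \<and> claim (pfst (pfst p)) (psnd (pfst p)) v \<in> set_decode s))"

text \<open>A pair is at least each of its components and a member of a coded set is below the code,
  so an intermediate value in \<open>justified\<close> is below \<open>s\<close>. This bounds the
  quantifier in the composition clause; \<open>bex_decode2\<close> does the same for sums and
  products.\<close>

lemma bex_decode1:
  "(\<exists>w. claim a x w \<in> set_decode s \<and> P w) \<longleftrightarrow> (\<exists>w<s. claim a x w \<in> set_decode s \<and> P w)"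
proof -
  have "w < s" if "claim a x w \<in> set_decode s" for w
    using mem_set_decode_less[OF that] le_prod_encode_2[of w x] le_prod_encode_2[of "pair x w" a]
    by linarith
  then show ?thesis by blast
qed

lemma bex_decode2:
  "(\<exists>u w. P u w \<and> claim a x u \<in> set_decode s \<and> claim b y w \<in> set_decode s)
    \<longleftrightarrow> (\<exists>u<s. \<exists>w<s. P u w \<and> claim a x u \<in> set_decode s \<and> claim b y w \<in> set_decode s)"
proof -
  have "w < s" if "claim a x w \<in> set_decode s" for w a x
    using mem_set_decode_less[OF that] le_prod_encode_2[of w x] le_prod_encode_2[of "pair x w" a]
    by linarith
  then show ?thesis by blast
qed

lemma elem_pred_certificate: "elem_pred (\<lambda>s. certificate (set_decode s))"
proof -
  have "certificate (set_decode s) \<longleftrightarrow> (\<forall>m<s. m \<in> set_decode s \<longrightarrow>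
      justified (set_decode s) (pfst m) (pfst (psnd m)) (psnd (psnd m)))" for s
    unfolding certificate_def using mem_set_decode_less by blast
  then show ?thesis
    unfolding justified_def bex_decode1 bex_decode2
    by (simp only:) (intro elem_intros elem_pred_mem)
qed

lemma elem_run: "elem run"
  unfolding run_def[abs_def]
  by (intro elem_intros elem_pred_mem elem_pred_comp[OF elem_pred_certificate])

text \<open>A subset of \<open>{..<n}\<close> has a code below \<open>2 ^ n\<close>, so the search
  meets the given certificate, and soundness excludes every other value. The value itself is a
  component of a claim below \<open>n\<close> and thus also within range.\<close>

lemma run_eq:
  assumes "certificate A" and "A \<subseteq> {..<n}" and "claim (code e) x (eval e x) \<in> A"
  shows "run (pair (pair (code e) x) (2 ^ n)) = eval e x"
proof -
  have fin: "finite A" using assms(2) finite_subset by blast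
  have "set_encode A \<le> set_encode {..<n}"
    unfolding set_encode_def using assms(2) by (intro sum_mono2) auto
  also have "set_encode {..<n} < 2 ^ n"
    by (induction n) (auto simp: set_encode_def lessThan_Suc)
  finally have less: "set_encode A < 2 ^ n" .
  have "eval e x \<le> claim (code e) x (eval e x)"
    by (meson le_prod_encode_2 le_trans)
  with assms have "eval e x < n" by auto
  then have val: "eval e x < 2 ^ n" using less_exp[of n] by linarith
  let ?P = "\<lambda>v. \<exists>s<2 ^ n. certificate (set_decode s) \<and> claim (code e) x v \<in> set_decode s"
  \<comment> \<open>Left to right is soundness; for the converse \<open>set_encode A\<close> is the
    witness.\<close>
  have P: "?P v \<longleftrightarrow> v = eval e x" for v
    using certificate_sound less assms(1,3) set_encode_inverse[OF fin] by metis
  have "run (pair (pair (code e) x) (2 ^ n)) = (\<Sum>v<2 ^ n. v * of_bool (?P v))"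
    by (simp add: run_def)
  also have "\<dots> = (\<Sum>v<2 ^ n. if v = eval e x then v else 0)"
    unfolding P by (intro sum.cong) auto
  finally show ?thesis using val by simp
qed

section \<open>Bounds on certificates\<close>

primrec tower :: "nat \<Rightarrow> nat \<Rightarrow> nat" where
  "tower 0 x = x"
| "tower (Suc k) x = 2 ^ tower k x"

lemma tower_add: "tower (k + l) x = tower k (tower l x)"
  by (induction k) auto

lemma tower_ge: "x \<le> tower k x"
  by (induction k) (auto intro: order_trans less_imp_le)

lemma tower_mono: "x \<le> y \<Longrightarrow> tower k x \<le> tower k y"
  by (induction k) auto

lemma tower_mono_height: "k \<le> l \<Longrightarrow> tower k x \<le> tower l x"
  by (metis le_add_diff_inverse2 tower_add tower_ge)

section \<open>Functions bounded by towers of fixed height\<close>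

definition dominated :: "(nat \<Rightarrow> nat) \<Rightarrow> bool" where
  "dominated f \<longleftrightarrow> (\<exists>k. \<forall>x. f x < tower k x)"

lemma dominated_le: "dominated g \<Longrightarrow> (\<And>x. f x \<le> g x) \<Longrightarrow> dominated f"
  unfolding dominated_def by (meson le_less_trans)

lemma dominated_comp:
  assumes "dominated f" and "dominated g"
  shows "dominated (\<lambda>x. f (g x))"
proof -
  obtain k l where "\<And>x. f x < tower k x" "\<And>x. g x < tower l x"
    using assms by (auto simp: dominated_def)
  then have "f (g x) < tower (k + l) x" for x
    unfolding tower_add by (meson less_imp_le order_less_le_trans tower_mono)
  then show ?thesis by (auto simp: dominated_def)
qed

lemma dominated_tower: "dominated (tower k)"
  unfolding dominated_def by (intro exI[of _ "Suc k"]) simp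

lemma dominated_id: "dominated (\<lambda>x. x)"
  by (rule dominated_le[OF dominated_tower[of 0]]) simp

lemma dominated_exp: "dominated f \<Longrightarrow> dominated (\<lambda>x. 2 ^ f x)"
  using dominated_comp[OF dominated_tower[of 1]] by simp

text \<open>Each exponentiation raises a value by at least one, so height \<open>Suc c\<close>
  exceeds \<open>c\<close> even at \<open>x = 0\<close>.\<close>

lemma dominated_const: "dominated (\<lambda>x. c)"
proof -
  have "c < tower (Suc c) x" for x
  proof (induction c)
    case (Suc c)
    then have "Suc c \<le> tower (Suc c) x" by (rule Suc_leI)
    also have "\<dots> < tower (Suc (Suc c)) x" by simp
    finally show ?case .
  qed simp
  then show ?thesis unfolding dominated_def by blast
qed

lemma dominated_add:
  assumes "dominated f" and "dominated g"
  shows "dominated (\<lambda>x. f x + g x)"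
proof -
  obtain k l where kl: "\<And>x. f x < tower k x" "\<And>x. g x < tower l x"
    using assms by (auto simp: dominated_def)
  \<comment> \<open>With both functions below a tower of the common height \<open>k + l\<close>, one
    more exponential absorbs the doubling.\<close>
  have double: "n + n \<le> 2 ^ n" for n :: nat
  proof (induction n)
    case (Suc n)
    then show ?case by (cases n) auto
  qed simp
  have "f x + g x \<le> 2 ^ tower (k + l) x" for x
  proof -
    have "f x \<le> tower (k + l) x" "g x \<le> tower (k + l) x"
      using kl[of x] tower_mono_height[of k "k + l" x] tower_mono_height[of l "k + l" x] by auto
    with double[of "tower (k + l) x"] show ?thesis by linarith
  qed
  then show ?thesis by (rule dominated_le[OF dominated_exp[OF dominated_tower]])
qed

lemma dominated_mult:
  assumes "dominated f" and "dominated g"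
  shows "dominated (\<lambda>x. f x * g x)"
proof (rule dominated_le[OF dominated_exp[OF dominated_add[OF assms]]])
  show "f x * g x \<le> 2 ^ (f x + g x)" for x
    unfolding power_add by (intro mult_mono) (auto intro: less_imp_le)
qed

lemma dominated_power:
  assumes "dominated f" and "dominated g"
  shows "dominated (\<lambda>x. f x ^ g x)"
proof (rule dominated_le[OF dominated_exp[OF dominated_mult[OF assms]]])
  show "f x ^ g x \<le> 2 ^ (f x * g x)" for x
    unfolding power_mult by (intro power_mono) (auto intro: less_imp_le)
qed

lemma dominated_pair:
  assumes "dominated f" and "dominated g"
  shows "dominated (\<lambda>x. pair (f x) (g x))"
proof (rule dominated_le)
  show "dominated (\<lambda>x. (f x + g x) * (f x + g x) + f x)"
    by (intro dominated_add dominated_mult assms)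
  have "triangle n \<le> n * n" for n by (induction n) auto
  then show "pair (f x) (g x) \<le> (f x + g x) * (f x + g x) + f x" for x
    by (simp add: prod_encode_def)
qed

lemma pair_mono: "a \<le> a' \<Longrightarrow> b \<le> b' \<Longrightarrow> pair a b \<le> pair a' b'"
  by (simp add: prod_encode_def add_mono triangle_mono)

lemma pfst_le: "pfst x \<le> x" and psnd_le: "psnd x \<le> x"
  by (metis le_prod_encode_1 prod.collapse prod_decode_inverse)
    (metis le_prod_encode_2 prod.collapse prod_decode_inverse)

section \<open>Certificates bounded by towers\<close>

text \<open>The height \<open>k\<close> depends on the term alone, so a fixed number of exponentials
  yields the search bound at every argument.\<close>

definition certified :: "uterm \<Rightarrow> bool" where
  "certified e \<longleftrightarrow> (\<exists>k. \<forall>x. \<exists>A\<subseteq>{..<tower k x}. certificate A \<and> claim (code e) x (eval e x) \<in> A)"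

lemma certifiedI:
  assumes "dominated h"
    and "\<And>x. \<exists>A\<subseteq>{..h x}. certificate A \<and> claim (code e) x (eval e x) \<in> A"
  shows "certified e"
proof -
  obtain k where "\<And>x. h x < tower k x" using assms(1) by (auto simp: dominated_def)
  then have "{..h x} \<subseteq> {..<tower k x}" for x by (auto intro: le_less_trans)
  then show ?thesis unfolding certified_def using assms(2) by (meson order_trans)
qed

text \<open>The value is a component of its claim, so bounding certificates also bounds the
  function. This makes the growth of subterms available in the induction for
  \<open>certified\<close>.\<close>

lemma dominated_eval_certified:
  assumes "certified e"
  shows "dominated (eval e)"
proof -
  obtain k where k: "\<And>x. \<exists>A\<subseteq>{..<tower k x}. certificate A \<and> claim (code e) x (eval e x) \<in> A"
    using assms by (auto simp: certified_def)
  have "eval e x < tower k x" for x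
  proof -
    have "claim (code e) x (eval e x) < tower k x" using k[of x] by blast
    moreover have "eval e x \<le> claim (code e) x (eval e x)" by (meson le_prod_encode_2 le_trans)
    ultimately show ?thesis by linarith
  qed
  then show ?thesis by (auto simp: dominated_def)
qed

lemma certified_axiom:
  assumes "\<And>x. justified {} (code e) x (eval e x)" and "dominated (eval e)"
  shows "certified e"
proof (rule certifiedI)
  show "dominated (\<lambda>x. claim (code e) x (eval e x))"
    by (intro dominated_pair dominated_const dominated_id assms)
  show "\<exists>A\<subseteq>{..claim (code e) x (eval e x)}. certificate A \<and> claim (code e) x (eval e x) \<in> A" for x
    by (rule exI[of _ "{claim (code e) x (eval e x)}"])
      (auto simp: certificate_def intro: justified_mono[OF assms(1)])
qed

text \<open>Serves \<open>Pair\<close> and \<open>Comp\<close>: \<open>f\<close> and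
  \<open>g\<close> give the arguments at which the subterms are evaluated. For
  \<open>Comp a b\<close> the function \<open>f\<close> is \<open>eval b\<close>, whose growth is
  bounded beforehand.\<close>

lemma certified_binary:
  assumes "certified a" and "certified b" and "dominated (eval e)"
    and "dominated f" and "dominated g"
    and "\<And>A x. claim (code a) (f x) (eval a (f x)) \<in> A \<Longrightarrow>
      claim (code b) (g x) (eval b (g x)) \<in> A \<Longrightarrow> justified A (code e) x (eval e x)"
  shows "certified e"
proof -
  obtain k where k: "\<And>x. \<exists>A\<subseteq>{..<tower k x}. certificate A \<and> claim (code a) x (eval a x) \<in> A"
    using assms(1) by (auto simp: certified_def)
  obtain l where l: "\<And>x. \<exists>A\<subseteq>{..<tower l x}. certificate A \<and> claim (code b) x (eval b x) \<in> A"
    using assms(2) by (auto simp: certified_def)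
  let ?m = "\<lambda>x. claim (code e) x (eval e x)"
  show ?thesis
  proof (rule certifiedI)
    show "dominated (\<lambda>x. ?m x + (tower k (f x) + tower l (g x)))"
      by (intro dominated_add dominated_pair dominated_const dominated_id assms
          dominated_comp[OF dominated_tower])
  next
    fix x
    obtain A where A: "A \<subseteq> {..<tower k (f x)}" "certificate A"
      "claim (code a) (f x) (eval a (f x)) \<in> A" using k[of "f x"] by blast
    obtain B where B: "B \<subseteq> {..<tower l (g x)}" "certificate B"
      "claim (code b) (g x) (eval b (g x)) \<in> B" using l[of "g x"] by blast
    have "certificate (insert (?m x) (A \<union> B))"
      using A B by (intro certificate_insert certificate_Un assms(6)) auto
    moreover have "insert (?m x) (A \<union> B) \<subseteq> {..?m x + (tower k (f x) + tower l (g x))}"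
      using A(1) B(1) by fastforce
    ultimately show "\<exists>A\<subseteq>{..?m x + (tower k (f x) + tower l (g x))}. certificate A \<and> ?m x \<in> A"
      by blast
  qed
qed

text \<open>Serves \<open>Sum\<close> and \<open>Prod\<close>, with \<open>S p z\<close> the partial
  result for bound \<open>z\<close>. The certificate unites those of \<open>e\<close> at
  \<open>pair p z\<close> for \<open>z < y\<close> with the claims for all partial results up to
  \<open>y\<close>; \<open>b\<close> bounds the latter.\<close>

lemma certified_recursion:
  assumes cert: "certified e"
    and val: "\<And>x. eval d x = S (pfst x) (psnd x)"
    and dom: "dominated b" and le: "\<And>x z. z \<le> psnd x \<Longrightarrow> S (pfst x) z \<le> b x"
    and zero: "\<And>p. justified {} (code d) (pair p 0) (S p 0)"
    and step: "\<And>A p z. claim (code d) (pair p z) (S p z) \<in> A \<Longrightarrow>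
      claim (code e) (pair p z) (eval e (pair p z)) \<in> A \<Longrightarrow>
      justified A (code d) (pair p (Suc z)) (S p (Suc z))"
  shows "certified d"
proof -
  obtain k where "\<forall>x. \<exists>A\<subseteq>{..<tower k x}. certificate A \<and> claim (code e) x (eval e x) \<in> A"
    using cert by (auto simp: certified_def)
  then obtain A where A: "\<And>x. A x \<subseteq> {..<tower k x}" "\<And>x. certificate (A x)"
    "\<And>x. claim (code e) x (eval e x) \<in> A x" by metis
  show ?thesis
  proof (rule certifiedI)
    show "dominated (\<lambda>x. claim (code d) x (b x) + tower k x)"
      by (intro dominated_add dominated_pair dominated_const dominated_id dom dominated_tower)
  next
    fix x
    define p y where "p = pfst x" and "y = psnd x"
    have x: "x = pair p y" by (simp add: p_def y_def)
    let ?m = "\<lambda>z. claim (code d) (pair p z) (S p z)"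
    have cert_upto: "certificate ((\<Union>z<n. A (pair p z)) \<union> ?m ` {..n})" for n
    proof (induction n)
      case 0
      have "certificate {}" by (simp add: certificate_def)
      from certificate_insert[OF this justified_mono[OF zero]] show ?case by simp
    next
      case (Suc n)
      let ?C = "A (pair p n) \<union> ((\<Union>z<n. A (pair p z)) \<union> ?m ` {..n})"
      have "certificate (insert (?m (Suc n)) ?C)"
      proof (rule certificate_insert)
        show "certificate ?C" by (rule certificate_Un[OF A(2) Suc.IH])
        show "justified (insert (?m (Suc n)) ?C) (code d) (pair p (Suc n)) (S p (Suc n))"
          using A(3)[of "pair p n"] by (intro step) auto
      qed
      moreover have "insert (?m (Suc n)) ?C = (\<Union>z<Suc n. A (pair p z)) \<union> ?m ` {..Suc n}"
        by (auto simp: lessThan_Suc atMost_Suc)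
      ultimately show ?case by simp
    qed
    have "?m z \<le> claim (code d) x (b x)" if "z \<le> y" for z
      using le[of z x] that by (auto simp: x intro!: pair_mono)
    \<comment> \<open>All arguments \<open>pair p z\<close> with \<open>z < y\<close> are at most
      \<open>x\<close>, so by monotonicity of the tower one bound covers the certificates at all of
      them.\<close>
    moreover have "m \<le> tower k x" if "m \<in> A (pair p z)" "z < y" for m z
      using A(1)[of "pair p z"] tower_mono[OF pair_mono[of p p z y], of k] that
      by (force simp: x)
    ultimately have "(\<Union>z<y. A (pair p z)) \<union> ?m ` {..y} \<subseteq> {..claim (code d) x (b x) + tower k x}"
      by (intro Un_least UN_least) (auto intro: trans_le_add1 trans_le_add2)
    moreover have "claim (code d) x (eval d x) \<in> ?m ` {..y}"
      by (auto simp: val x)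
    ultimately show "\<exists>A\<subseteq>{..claim (code d) x (b x) + tower k x}.
        certificate A \<and> claim (code d) x (eval d x) \<in> A"
      using cert_upto[of y] by blast
  qed
qed

lemma certified: "certified e"
proof (induction e)
  case (Const c)
  show ?case by (rule certified_axiom) (auto simp: justified_def intro: dominated_const)
next
  case Fst
  show ?case by (rule certified_axiom)
    (auto simp: justified_def intro: dominated_le[OF dominated_id] pfst_le)
next
  case Snd
  show ?case by (rule certified_axiom)
    (auto simp: justified_def intro: dominated_le[OF dominated_id] psnd_le)
next
  case Add
  show ?case by (rule certified_axiom)
    (auto simp: justified_def add_mono pfst_le psnd_le
      intro: dominated_le[OF dominated_add[OF dominated_id dominated_id]])
next
  case Monus
  have "pfst x - psnd x \<le> x" for x using pfst_le[of x] by linarith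
  then show ?case by (intro certified_axiom)
    (auto simp: justified_def intro: dominated_le[OF dominated_id])
next
  case (Pair a b)
  show ?case
    by (rule certified_binary[OF Pair _ dominated_id dominated_id])
      (auto simp: justified_def intro: dominated_pair dominated_eval_certified Pair)
next
  case (Comp a b)
  show ?case
    by (rule certified_binary[OF Comp _ dominated_eval_certified[OF Comp(2)] dominated_id])
      (auto simp: justified_def intro: dominated_comp dominated_eval_certified Comp)
next
  case (Sum e)
  obtain k where k: "\<And>x. eval e x < tower k x"
    using dominated_eval_certified[OF Sum] by (auto simp: dominated_def)
  show ?case
  proof (rule certified_recursion[OF Sum, where S = "\<lambda>p y. \<Sum>z<y. eval e (pair p z)"])
    \<comment> \<open>There are at most \<open>psnd x \<le> x\<close> summands, each taken at an
      argument not exceeding \<open>x\<close>.\<close>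
    show "dominated (\<lambda>x. x * tower k x)"
      by (intro dominated_mult dominated_id dominated_tower)
    show "(\<Sum>i<z. eval e (pair (pfst x) i)) \<le> x * tower k x" if "z \<le> psnd x" for x z
    proof -
      have "eval e (pair (pfst x) i) \<le> tower k x" if "i < z" for i
        using k[of "pair (pfst x) i"] pair_mono[of "pfst x" "pfst x" i "psnd x"] that \<open>z \<le> psnd x\<close>
          tower_mono[of "pair (pfst x) i" x k] by simp
      then have "(\<Sum>i<z. eval e (pair (pfst x) i)) \<le> (\<Sum>i<z. tower k x)"
        by (intro sum_mono) simp
      also have "\<dots> \<le> x * tower k x"
        using that psnd_le[of x] by simp
      finally show ?thesis .
    qed
  qed (auto simp: justified_def)
next
  case (Prod e)
  obtain k where k: "\<And>x. eval e x < tower k x"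
    using dominated_eval_certified[OF Prod] by (auto simp: dominated_def)
  show ?case
  proof (rule certified_recursion[OF Prod, where S = "\<lambda>p y. \<Prod>z<y. eval e (pair p z)"])
    show "dominated (\<lambda>x. tower k x ^ x)"
      by (intro dominated_power dominated_id dominated_tower)
    show "(\<Prod>i<z. eval e (pair (pfst x) i)) \<le> tower k x ^ x" if "z \<le> psnd x" for x z
    proof -
      have "eval e (pair (pfst x) i) \<le> tower k x" if "i < z" for i
        using k[of "pair (pfst x) i"] pair_mono[of "pfst x" "pfst x" i "psnd x"] that \<open>z \<le> psnd x\<close>
          tower_mono[of "pair (pfst x) i" x k] by simp
      then have "(\<Prod>i<z. eval e (pair (pfst x) i)) \<le> (\<Prod>i<z. tower k x)"
        by (intro prod_mono) simp
      also have "\<dots> \<le> tower k x ^ x"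
        \<comment> \<open>The strict bound \<open>k\<close> makes the base positive, which allows
          the exponent to grow from \<open>z\<close> to \<open>x\<close>.\<close>
        using that psnd_le[of x] k[of x] by (simp add: power_increasing)
      finally show ?thesis .
    qed
  qed (auto simp: justified_def)
qed

section \<open>The basis\<close>

definition init :: "nat \<Rightarrow> nat" where
  "init x = pair (pair 0 x) x"

text \<open>Iteration reaches the code of every term from 0, so a single function replaces one
  constant code per term.\<close>

definition next_code :: "nat \<Rightarrow> nat" where
  "next_code p = pair (pair (pfst (pfst p) + 1) (psnd (pfst p))) (psnd p)"

definition raise_bound :: "nat \<Rightarrow> nat" where
  "raise_bound p = pair (pfst p) (2 ^ psnd p)"

lemma funpow_next_code: "(next_code ^^ n) (pair (pair c x) t) = pair (pair (c + n) x) t"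
  by (induction n) (auto simp: next_code_def)

lemma funpow_raise_bound: "(raise_bound ^^ k) (pair q t) = pair q (tower k t)"
  by (induction k) (auto simp: raise_bound_def)

lemma eval_eq_run:
  "\<exists>k. eval e = run \<circ> (raise_bound ^^ k) \<circ> (next_code ^^ code e) \<circ> init"
proof -
  obtain k where k: "\<And>x. \<exists>A\<subseteq>{..<tower k x}. certificate A \<and> claim (code e) x (eval e x) \<in> A"
    using certified[of e] by (auto simp: certified_def)
  \<comment> \<open>\<open>run_eq\<close> takes a bound of the form \<open>2 ^ n\<close>, here with
    \<open>n = tower k x\<close>; hence one level above the height of the certificate bound.\<close>
  have "run (pair (pair (code e) x) (tower (Suc k) x)) = eval e x" for x
  proof -
    obtain A where "A \<subseteq> {..<tower k x}" "certificate A" "claim (code e) x (eval e x) \<in> A"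
      using k[of x] by blast
    from run_eq[OF this(2,1,3)] show ?thesis by simp
  qed
  then have "eval e = run \<circ> (raise_bound ^^ Suc k) \<circ> (next_code ^^ code e) \<circ> init"
    unfolding comp_def init_def funpow_next_code funpow_raise_bound by simp
  then show ?thesis ..
qed

lemma closure_funpow:
  "f \<in> unary_substitution_closure U \<Longrightarrow> f ^^ n \<in> unary_substitution_closure U"
proof (induction n)
  case 0
  show ?case using unary_substitution_closure.ident[of U] by (simp add: id_def[symmetric])
qed (simp add: unary_substitution_closure.comp)

lemma closure_elem:
  assumes "\<And>f. f \<in> U \<Longrightarrow> elem f" and "f \<in> unary_substitution_closure U"
  shows "elem f"
  using assms(2)
proof induction
  case (comp f g)
  then show ?case unfolding comp_def by (intro elem_comp[of f g])
qed (auto simp: id_def intro: assms(1) elem_const elem_id)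

theorem theorem17:
  "\<exists>U :: (nat \<Rightarrow> nat) set. finite U \<and> substitution_basis U unary_kalmar_elementary"
proof -
  let ?U = "{init, next_code, raise_bound, run}"
  have "elem f" if "f \<in> ?U" for f
  proof -
    have "elem init" "elem next_code" "elem raise_bound"
      unfolding init_def[abs_def] next_code_def[abs_def] raise_bound_def[abs_def]
      by (intro elem_intros)+
    with elem_run that show ?thesis by blast
  qed
  then have "unary_substitution_closure ?U \<subseteq> range eval"
    using closure_elem unfolding elem_def by blast
  moreover have "eval e \<in> unary_substitution_closure ?U" for e
  proof -
    obtain k where "eval e = run \<circ> (raise_bound ^^ k) \<circ> (next_code ^^ code e) \<circ> init"
      using eval_eq_run by blast
    moreover have "run \<circ> (raise_bound ^^ k) \<circ> (next_code ^^ code e) \<circ> init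
        \<in> unary_substitution_closure ?U"
      by (intro unary_substitution_closure.comp closure_funpow unary_substitution_closure.base)
        simp_all
    ultimately show ?thesis by (simp only:)
  qed
  ultimately have "substitution_basis ?U unary_kalmar_elementary"
    unfolding substitution_basis_def unary_kalmar_elementary_eq by blast
  then show ?thesis by (intro exI[of _ ?U]) simp
qed

end
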